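(* Let $M\in\mathbb{R}^{n\times n}$ be symmetric positive definite and let $d_{h_1},\dots,d_{h_k}\in\mathbb{R}^n$ be vectors with strictly positive entries. Put $D_{h_i}=\mathrm{diagm}(d_{h_i})$. Let $(\tau^\star,z^\star)$ be an optimal solution of the semidefinite program $$\max_{\tau\in\mathbb{R},\,z\in\mathbb{R}^k}\ \tau\quad\text{subject to}\quad \tau M-\sum_{i=1}^k z_iD_{h_i}\preceq 0,\qquad \sum_{i=1}^k z_iD_{h_i}-M\preceq 0,$$ and let $D_{\mathcal H}^\star=\sum_{i=1}^k z_i^\star D_{h_i}$. Then $$\kappa\big((D_{\mathcal H}^\star)^{-1/2}M(D_{\mathcal H}^\star)^{-1/2}\big)\le \min_{1\le i\le k}\ \kappa\big(D_{h_i}^{-1/2}MD_{h_i}^{-1/2}\big).$$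
   Context: For a symmetric positive definite matrix $A$, $\kappa(A)=\lambda_{\max}(A)/\lambda_{\min}(A)$ is its condition number. $\mathrm{diagm}(d)$ is the diagonal matrix with the vector $d$ on its diagonal. $A\preceq B$ means that $B-A$ is positive semidefinite. The matrix $D_{\mathcal H}^\star$ is called the optimal diagonal preconditioner in the subspace $\mathrm{span}\{d_{h_1},\dots,d_{h_k}\}$. *)

theory Defs
  imports "HOL-Analysis.Analysis"
begin

definition symmetric :: "real ^ 'n ^ 'n \<Rightarrow> bool" where
  "symmetric A \<longleftrightarrow> transpose A = A"

definition pos_def :: "real ^ 'n ^ 'n \<Rightarrow> bool" where
  "pos_def A \<longleftrightarrow> symmetric A \<and> (\<forall>x. x \<noteq> 0 \<longrightarrow> 0 < x \<bullet> (A *v x))"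

definition pos_semidef :: "real ^ 'n ^ 'n \<Rightarrow> bool" where
  "pos_semidef A \<longleftrightarrow> symmetric A \<and> (\<forall>x. 0 \<le> x \<bullet> (A *v x))"

definition loewner_le :: "real ^ 'n ^ 'n \<Rightarrow> real ^ 'n ^ 'n \<Rightarrow> bool" (infix "\<preceq>" 50) where
  "A \<preceq> B \<longleftrightarrow> pos_semidef (B - A)"

definition diagm :: "real ^ 'n \<Rightarrow> real ^ 'n ^ 'n" where
  "diagm d = (\<chi> i j. if i = j then d $ i else 0)"

definition eigenvalues :: "real ^ 'n ^ 'n \<Rightarrow> real set" where
  "eigenvalues A = {l. \<exists>v. v \<noteq> 0 \<and> A *v v = l *\<^sub>R v}"

(* For symmetric A the set of (real) eigenvalues is finite and nonempty, so Max and Min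
   are the largest and the smallest eigenvalue. *)
definition lambda_max :: "real ^ 'n ^ 'n \<Rightarrow> real" where
  "lambda_max A = Max (eigenvalues A)"

definition lambda_min :: "real ^ 'n ^ 'n \<Rightarrow> real" where
  "lambda_min A = Min (eigenvalues A)"

(* Used for symmetric positive definite A, where lambda_min A > 0. *)
definition cond_num :: "real ^ 'n ^ 'n \<Rightarrow> real" where
  "cond_num A = lambda_max A / lambda_min A"

(* The principal square root: a positive semidefinite matrix has exactly one
   positive semidefinite square root. *)
definition matrix_sqrt :: "real ^ 'n ^ 'n \<Rightarrow> real ^ 'n ^ 'n" where
  "matrix_sqrt A = (THE B. pos_semidef B \<and> B ** B = A)"

(* The power A^(-1/2), for positive definite A. *)
definition inv_sqrt :: "real ^ 'n ^ 'n \<Rightarrow> real ^ 'n ^ 'n" where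
  "inv_sqrt A = matrix_inv (matrix_sqrt A)"

definition precond :: "real ^ 'n ^ 'n \<Rightarrow> real ^ 'n ^ 'n \<Rightarrow> real ^ 'n ^ 'n" where
  "precond D M = inv_sqrt D ** M ** inv_sqrt D"

definition diag_comb :: "('k :: finite \<Rightarrow> real ^ 'n) \<Rightarrow> real ^ 'k \<Rightarrow> real ^ 'n ^ 'n" where
  "diag_comb d z = (\<Sum>i\<in>UNIV. z $ i *\<^sub>R diagm (d i))"

definition sdp_feasible ::
  "real ^ 'n ^ 'n \<Rightarrow> ('k :: finite \<Rightarrow> real ^ 'n) \<Rightarrow> real \<Rightarrow> real ^ 'k \<Rightarrow> bool" where
  "sdp_feasible M d \<tau> z \<longleftrightarrow> \<tau> *\<^sub>R M - diag_comb d z \<preceq> 0 \<and> diag_comb d z - M \<preceq> 0"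

definition sdp_optimal ::
  "real ^ 'n ^ 'n \<Rightarrow> ('k :: finite \<Rightarrow> real ^ 'n) \<Rightarrow> real \<Rightarrow> real ^ 'k \<Rightarrow> bool" where
  "sdp_optimal M d \<tau> z \<longleftrightarrow>
     sdp_feasible M d \<tau> z \<and> (\<forall>\<tau>' z'. sdp_feasible M d \<tau>' z' \<longrightarrow> \<tau>' \<le> \<tau>)"

end

theory Submission
  imports Defs
begin

text \<open>
  The substitution \<open>y = D^(-1/2) x\<close> turns the extreme eigenvalues of the preconditioned matrix into
  Loewner bounds: \<open>a \<le> \<lambda>\<^sub>m\<^sub>i\<^sub>n\<close> iff \<open>a D \<preceq> M\<close>, and \<open>\<lambda>\<^sub>m\<^sub>a\<^sub>x \<le> b\<close> iff \<open>M \<preceq> b D\<close>. Hence rescaling \<open>D\<^sub>i\<close> by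
  its own \<open>\<lambda>\<^sub>m\<^sub>i\<^sub>n\<close> gives a feasible point of the program with value \<open>1 / \<kappa>\<^sub>i\<close>, so that
  \<open>\<tau> \<ge> 1 / \<kappa>\<^sub>i > 0\<close>; conversely, \<open>\<tau> M \<preceq> D \<preceq> M\<close> puts all eigenvalues for the optimal \<open>D\<close> between
  \<open>1\<close> and \<open>1 / \<tau>\<close>.
\<close>

section \<open>Extreme eigenvalues of symmetric matrices\<close>

lemma symmetric_inner:
  fixes A :: "real ^ 'n ^ 'n"
  assumes "symmetric A"
  shows "x \<bullet> (A *v y) = (A *v x) \<bullet> y"
  using assms by (metis symmetric_def dot_lmul_matrix transpose_matrix_vector)

lemma uminus_matrix_vector_mult: "(- A) *v x = - (A *v x)" for A :: "real ^ 'n ^ 'm"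
  using matrix_vector_mult_diff_rdistrib[of 0 A x] by simp

text \<open>Eigenvectors of distinct eigenvalues are orthogonal, so choosing one per eigenvalue
  gives an independent family, which is finite. Without this, \<open>Max\<close> and
  \<open>Min\<close> of the spectrum would say nothing.\<close>

lemma finite_eigenvalues:
  fixes A :: "real ^ 'n ^ 'n"
  assumes "symmetric A"
  shows "finite (eigenvalues A)"
proof -
  have "\<forall>l\<in>eigenvalues A. \<exists>v. v \<noteq> 0 \<and> A *v v = l *\<^sub>R v"
    by (auto simp: eigenvalues_def)
  then obtain v where v: "\<And>l. l \<in> eigenvalues A \<Longrightarrow> v l \<noteq> 0 \<and> A *v v l = l *\<^sub>R v l"
    by metis
  have ortho: "v l \<bullet> v m = 0" if "l \<in> eigenvalues A" "m \<in> eigenvalues A" "l \<noteq> m" for l m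
    using symmetric_inner[OF assms, of "v l" "v m"] v[OF that(1)] v[OF that(2)] that(3) by simp
  have "inj_on v (eigenvalues A)"
    using ortho v by (metis inj_onI inner_eq_zero_iff)
  moreover have "pairwise orthogonal (v ` eigenvalues A)"
    using ortho by (auto simp: pairwise_def orthogonal_def)
  then have "independent (v ` eigenvalues A)"
    using v by (intro pairwise_orthogonal_independent) auto
  then have "finite (v ` eigenvalues A)"
    by (rule independent_imp_finite)
  ultimately show ?thesis
    using finite_imageD by blast
qed

lemma quadratic_nonneg_imp_linear_zero:
  fixes a b :: real
  assumes "\<And>t. 0 \<le> a * t\<^sup>2 + b * t"
  shows "b = 0"
proof (rule ccontr)
  assume "b \<noteq> 0"
  \<comment> \<open>This \<open>s\<close> is positive and exceeds \<open>a\<close>, so at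
    \<open>t = - b / s\<close> the linear term outweighs the quadratic one.\<close>
  define s where "s = \<bar>a\<bar> + 1"
  have s: "s > 0" "a < s" by (auto simp: s_def)
  have "0 \<le> a * (- b / s)\<^sup>2 + b * (- b / s)" by (rule assms)
  also have "\<dots> = (a - s) * (b / s)\<^sup>2"
    using s by (simp add: field_simps power2_eq_square)
  also have "\<dots> < 0"
    using s \<open>b \<noteq> 0\<close> by (simp add: mult_neg_pos)
  finally show False by simp
qed

text \<open>Such an \<open>x\<close> minimises the form, so the first variation
  \<open>2 * ((B *v x) \<bullet> y)\<close> vanishes in every direction \<open>y\<close>; the
  direction \<open>y = B *v x\<close> finishes.\<close>

lemma psd_form_zero_imp_kernel:
  fixes B :: "real ^ 'n ^ 'n"
  assumes "pos_semidef B" and "x \<bullet> (B *v x) = 0"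
  shows "B *v x = 0"
proof -
  let ?y = "B *v x"
  have "symmetric B" and nonneg: "\<And>u. 0 \<le> u \<bullet> (B *v u)"
    using assms(1) by (auto simp: pos_semidef_def)
  have expand: "(x + t *\<^sub>R y) \<bullet> (B *v (x + t *\<^sub>R y)) =
      (y \<bullet> (B *v y)) * t\<^sup>2 + 2 * ((B *v x) \<bullet> y) * t" for t y
  proof -
    have "x \<bullet> (B *v y) = (B *v x) \<bullet> y"
      by (rule symmetric_inner[OF \<open>symmetric B\<close>])
    moreover have "y \<bullet> (B *v x) = (B *v x) \<bullet> y"
      by (rule inner_commute)
    ultimately show ?thesis
      using assms(2)
      by (simp add: matrix_vector_right_distrib matrix_vector_mult_scaleR inner_add_left
          inner_add_right power2_eq_square ring_distribs)
  qed
  have "2 * (?y \<bullet> ?y) = 0"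
    by (rule quadratic_nonneg_imp_linear_zero[where a = "?y \<bullet> (B *v ?y)"]) (metis expand nonneg)
  then show ?thesis by simp
qed

lemma symmetric_shift:
  fixes A :: "real ^ 'n ^ 'n"
  assumes "symmetric A"
  shows "symmetric (A - c *\<^sub>R mat 1)"
  using assms by (simp add: symmetric_def transpose_def mat_def vec_eq_iff)

text \<open>The form attains its minimum \<open>l\<close> on the compact unit sphere. Then
  \<open>A - l *\<^sub>R mat 1\<close> is positive semidefinite and its form vanishes at the
  minimiser, which therefore lies in its kernel and is an eigenvector.\<close>

lemma exists_rayleigh_min_eigenvalue:
  fixes A :: "real ^ 'n ^ 'n"
  assumes "symmetric A"
  shows "\<exists>l\<in>eigenvalues A. \<forall>x. l * (x \<bullet> x) \<le> x \<bullet> (A *v x)"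
proof -
  have "continuous_on (sphere 0 1) (\<lambda>x. x \<bullet> (A *v x))"
    by (intro continuous_intros matrix_vector_mult_linear_continuous_on)
  moreover have "sphere (0 :: real ^ 'n) 1 \<noteq> {}" by simp
  ultimately have "\<exists>v\<in>sphere 0 1. \<forall>x\<in>sphere 0 1. v \<bullet> (A *v v) \<le> x \<bullet> (A *v x)"
    by (intro continuous_attains_inf compact_sphere)
  then obtain v where v: "norm v = 1"
    and min: "\<And>x. norm x = 1 \<Longrightarrow> v \<bullet> (A *v v) \<le> x \<bullet> (A *v x)"
    by auto
  define l where "l = v \<bullet> (A *v v)"
  have bound: "l * (x \<bullet> x) \<le> x \<bullet> (A *v x)" for x
  proof (cases "x = 0")
    case False
    \<comment> \<open>Both sides are homogeneous of degree 2, so it suffices to normalise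
      \<open>x\<close>.\<close>
    have "l \<le> (x /\<^sub>R norm x) \<bullet> (A *v (x /\<^sub>R norm x))"
      unfolding l_def using False by (intro min) simp
    also have "\<dots> = (x \<bullet> (A *v x)) / (x \<bullet> x)"
      by (simp add: matrix_vector_mult_scaleR dot_square_norm power2_eq_square divide_inverse)
    finally show ?thesis
      using False by (simp add: pos_le_divide_eq)
  qed simp
  have form: "x \<bullet> ((A - l *\<^sub>R mat 1) *v x) = x \<bullet> (A *v x) - l * (x \<bullet> x)" for x
    by (simp add: matrix_vector_mult_diff_rdistrib scaleR_matrix_vector_assoc[symmetric]
        inner_diff_right)
  have "pos_semidef (A - l *\<^sub>R mat 1)"
    using bound form symmetric_shift[OF assms] by (simp add: pos_semidef_def)
  moreover have "v \<bullet> ((A - l *\<^sub>R mat 1) *v v) = 0"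
    using v form[of v] by (simp add: l_def dot_square_norm)
  ultimately have "(A - l *\<^sub>R mat 1) *v v = 0"
    by (rule psd_form_zero_imp_kernel)
  then have "A *v v = l *\<^sub>R v"
    by (simp add: matrix_vector_mult_diff_rdistrib scaleR_matrix_vector_assoc[symmetric])
  then have "l \<in> eigenvalues A"
    using v by (auto simp: eigenvalues_def intro!: exI[of _ v])
  with bound show ?thesis by blast
qed

lemma eigenvalues_uminus: "eigenvalues (- A) = uminus ` eigenvalues A"
proof -
  have "l \<in> eigenvalues (- A) \<longleftrightarrow> - l \<in> eigenvalues A" for l
  proof -
    have "- (A *v v) = l *\<^sub>R v \<longleftrightarrow> A *v v = - (l *\<^sub>R v)" for v
      by (metis minus_minus)
    then show ?thesis
      by (simp add: eigenvalues_def uminus_matrix_vector_mult)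
  qed
  then show ?thesis
    by (force simp: image_iff)
qed

lemma eigenvalue_quotient:
  assumes "l \<in> eigenvalues A"
  obtains v where "v \<noteq> 0" "v \<bullet> (A *v v) = l * (v \<bullet> v)"
  using assms by (auto simp: eigenvalues_def)

text \<open>The eigenvalue \<open>l\<close> that bounds the Rayleigh quotient is below every other
  eigenvalue, as testing the bound on eigenvectors shows; hence it is the minimum of the
  spectrum.\<close>

lemma le_lambda_min_iff:
  fixes A :: "real ^ 'n ^ 'n"
  assumes "symmetric A"
  shows "c \<le> lambda_min A \<longleftrightarrow> (\<forall>x. c * (x \<bullet> x) \<le> x \<bullet> (A *v x))"
proof -
  obtain l where l: "l \<in> eigenvalues A" and bound: "\<And>x. l * (x \<bullet> x) \<le> x \<bullet> (A *v x)"
    using exists_rayleigh_min_eigenvalue[OF assms] by blast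
  have "l \<le> m" if "m \<in> eigenvalues A" for m
    using that bound by (metis eigenvalue_quotient inner_gt_zero_iff mult_le_cancel_right_pos)
  then have "lambda_min A = l"
    unfolding lambda_min_def using finite_eigenvalues[OF assms] l by (intro Min_eqI)
  moreover have "c \<le> l" if "\<forall>x. c * (x \<bullet> x) \<le> x \<bullet> (A *v x)"
    using that l by (metis eigenvalue_quotient inner_gt_zero_iff mult_le_cancel_right_pos)
  moreover have "c * (x \<bullet> x) \<le> x \<bullet> (A *v x)" if "c \<le> l" for x
    using that bound[of x] mult_right_mono[of c l "x \<bullet> x"] by simp
  ultimately show ?thesis by blast
qed

lemma lambda_max_conv_min:
  fixes A :: "real ^ 'n ^ 'n"
  assumes "symmetric A"
  shows "lambda_max A = - lambda_min (- A)"
proof -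
  have "eigenvalues A \<noteq> {}"
    using exists_rayleigh_min_eigenvalue[OF assms] by blast
  then show ?thesis
    unfolding lambda_max_def lambda_min_def eigenvalues_uminus
    using minus_Max_eq_Min[of "eigenvalues A"] finite_eigenvalues[OF assms] by linarith
qed

lemma lambda_max_le_iff:
  fixes A :: "real ^ 'n ^ 'n"
  assumes "symmetric A"
  shows "lambda_max A \<le> c \<longleftrightarrow> (\<forall>x. x \<bullet> (A *v x) \<le> c * (x \<bullet> x))"
proof -
  have "symmetric (- A)"
    using assms by (simp add: symmetric_def transpose_def vec_eq_iff)
  then have "- c \<le> lambda_min (- A) \<longleftrightarrow> (\<forall>x. x \<bullet> (A *v x) \<le> c * (x \<bullet> x))"
    by (simp add: le_lambda_min_iff uminus_matrix_vector_mult)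
  then show ?thesis
    using lambda_max_conv_min[OF assms] by auto
qed

lemma lambda_min_le_max:
  fixes A :: "real ^ 'n ^ 'n"
  assumes "symmetric A"
  shows "lambda_min A \<le> lambda_max A"
proof -
  have "eigenvalues A \<noteq> {}"
    using exists_rayleigh_min_eigenvalue[OF assms] by blast
  then show ?thesis
    unfolding lambda_max_def lambda_min_def
    using finite_eigenvalues[OF assms] by (meson Max_ge Min_in order.trans Min_le)
qed

lemma pos_def_lambda_min_pos:
  fixes A :: "real ^ 'n ^ 'n"
  assumes "pos_def A"
  shows "0 < lambda_min A"
proof -
  have sym: "symmetric A" using assms by (simp add: pos_def_def)
  obtain l where "l \<in> eigenvalues A" "\<And>x. l * (x \<bullet> x) \<le> x \<bullet> (A *v x)"
    using exists_rayleigh_min_eigenvalue[OF sym] by blast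
  moreover from this(1) have "0 < l"
    using assms unfolding pos_def_def
    by (metis eigenvalue_quotient inner_ge_zero linorder_not_less zero_less_mult_iff)
  moreover have "l \<le> lambda_min A"
    using calculation(2) le_lambda_min_iff[OF sym] by blast
  ultimately show ?thesis by simp
qed

section \<open>Diagonal preconditioners\<close>

lemma diagm_mult_vec: "(diagm w *v x) $ i = w $ i * x $ i"
  by (simp add: diagm_def matrix_vector_mult_def if_distrib[of "\<lambda>a. a * _"] cong: if_cong)

lemma symmetric_diagm: "symmetric (diagm w)"
  by (auto simp: symmetric_def transpose_def diagm_def vec_eq_iff)

lemma diagm_mult_nth: "(diagm w ** A) $ i $ j = w $ i * A $ i $ j"
  by (simp add: diagm_def matrix_matrix_mult_def if_distrib[of "\<lambda>a. a * _"] cong: if_cong)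

lemma mult_diagm_nth: "(A ** diagm w) $ i $ j = A $ i $ j * w $ j"
  for A :: "real ^ 'n ^ 'm"
  by (simp add: diagm_def matrix_matrix_mult_def if_distrib[of "\<lambda>a. _ * a"] cong: if_cong)

lemma diagm_mult_diagm: "diagm v ** diagm w = diagm (\<chi> i. v $ i * w $ i)"
  by (simp add: vec_eq_iff diagm_mult_nth) (simp add: diagm_def)

lemma diagm_inner: "x \<bullet> (diagm w *v x) = (\<Sum>i\<in>UNIV. w $ i * (x $ i)\<^sup>2)"
  by (simp add: inner_vec_def diagm_mult_vec power2_eq_square mult.left_commute)

lemma pos_def_diagm:
  assumes "\<forall>i. 0 < w $ i"
  shows "pos_def (diagm w)"
  unfolding pos_def_def
proof (intro conjI allI impI)
  fix x :: "real ^ 'a" assume "x \<noteq> 0"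
  then obtain j where "x $ j \<noteq> 0" by (auto simp: vec_eq_iff)
  with assms show "0 < x \<bullet> (diagm w *v x)"
    unfolding diagm_inner by (intro sum_pos2[where i = j]) (auto simp: less_imp_le)
qed (rule symmetric_diagm)

text \<open>
  A square root \<open>B\<close> of \<open>diagm w\<close> commutes with \<open>diagm w\<close>, hence with \<open>S = diagm (sqrt w)\<close>, so
  \<open>(B + S) (B - S) = B\<^sup>2 - S\<^sup>2 = 0\<close>; and \<open>B + S\<close> is injective because it is positive definite.
\<close>
lemma matrix_sqrt_diagm:
  assumes w: "\<forall>i. 0 < w $ i"
  shows "matrix_sqrt (diagm w) = diagm (\<chi> i. sqrt (w $ i))"
proof -
  define S where "S = diagm (\<chi> i. sqrt (w $ i))"
  have pd: "pos_def S"
    unfolding S_def using w by (intro pos_def_diagm) simp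
  then have psd: "pos_semidef S"
    unfolding pos_def_def pos_semidef_def by (metis inner_zero_left less_imp_le order_refl)
  have sq: "S ** S = diagm w"
    using w by (simp add: S_def diagm_mult_diagm less_imp_le)
  have unique: "B = S" if B: "pos_semidef B" "B ** B = diagm w" for B
  proof -
    have "B ** diagm w = diagm w ** B"
      using B(2) by (metis matrix_mul_assoc)
    then have "B $ i $ j * w $ j = w $ i * B $ i $ j" for i j
      by (metis diagm_mult_nth mult_diagm_nth)
    \<comment> \<open>Comparing entries, \<open>B\<close> can only mix indices with equal
      \<open>w\<close>. There the roots agree too, so commutation passes from \<open>diagm w\<close>
      to \<open>S\<close>.\<close>
    then have "B $ i $ j = 0 \<or> w $ i = w $ j" for i j
      by (metis mult.commute mult_cancel_left)
    then have "B $ i $ j * sqrt (w $ j) = sqrt (w $ i) * B $ i $ j" for i j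
      by (metis mult.commute mult_zero_left)
    then have comm: "B ** S = S ** B"
      by (simp add: vec_eq_iff S_def diagm_mult_nth mult_diagm_nth)
    have "B *v x = S *v x" for x
    proof (rule ccontr)
      let ?y = "B *v x - S *v x"
      assume "\<not> ?thesis"
      then have "?y \<noteq> 0" by simp
      then have "0 < ?y \<bullet> (B *v ?y) + ?y \<bullet> (S *v ?y)"
        using pd B(1) by (simp add: pos_def_def pos_semidef_def add_nonneg_pos)
      also have "\<dots> = ?y \<bullet> ((B ** B) *v x - (B ** S) *v x + (S ** B) *v x - (S ** S) *v x)"
        by (simp add: matrix_vector_mult_diff_distrib matrix_vector_mul_assoc
            inner_add_right inner_diff_right)
      also have "\<dots> = 0"
        using comm sq B(2) by simp
      finally show False by simp
    qed
    then show ?thesis by (simp add: matrix_eq)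
  qed
  show ?thesis
    unfolding matrix_sqrt_def S_def[symmetric]
    by (rule the_equality) (use psd sq unique in blast)+
qed

text \<open>\<open>matrix_inv\<close> is a choice among two-sided inverses; uniqueness of inverses
  makes it computable from a candidate.\<close>

lemma matrix_inv_unique:
  fixes A :: "real ^ 'n ^ 'n"
  assumes "A ** B = mat 1" "B ** A = mat 1"
  shows "matrix_inv A = B"
proof -
  have "A ** matrix_inv A = mat 1 \<and> matrix_inv A ** A = mat 1"
    unfolding matrix_inv_def by (rule someI[where x = B]) (use assms in simp)
  then show ?thesis
    using assms by (metis matrix_mul_assoc matrix_mul_lid matrix_mul_rid)
qed

lemma inv_sqrt_diagm:
  assumes w: "\<forall>i. 0 < w $ i"
  shows "inv_sqrt (diagm w) = diagm (\<chi> i. 1 / sqrt (w $ i))"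
proof -
  have "w $ i \<noteq> 0" for i
    using w by (metis less_irrefl)
  then show ?thesis
    unfolding inv_sqrt_def matrix_sqrt_diagm[OF w]
    by (intro matrix_inv_unique) (simp_all add: diagm_mult_diagm, simp_all add: diagm_def mat_def vec_eq_iff)
qed

section \<open>From eigenvalue bounds to Loewner bounds by a change of variables\<close>

context
  fixes w :: "real ^ 'n" and M :: "real ^ 'n ^ 'n"
  assumes w: "\<forall>i. 0 < w $ i" and M: "symmetric M"
begin

lemma symmetric_precond: "symmetric (precond (diagm w) M)"
proof -
  have "M $ j $ i = M $ i $ j" for i j
    using M by (simp add: symmetric_def transpose_def vec_eq_iff)
  then show ?thesis
    by (simp add: symmetric_def precond_def inv_sqrt_diagm[OF w] vec_eq_iff transpose_def
        diagm_mult_nth mult_diagm_nth mult.commute)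
qed

lemma precond_quadratic_form:
  fixes x :: "real ^ 'n"
  shows "x \<bullet> (precond (diagm w) M *v x) =
    (inv_sqrt (diagm w) *v x) \<bullet> (M *v (inv_sqrt (diagm w) *v x))"
proof -
  have "symmetric (inv_sqrt (diagm w))"
    by (simp add: inv_sqrt_diagm[OF w] symmetric_diagm)
  then show ?thesis
    by (simp add: precond_def matrix_vector_mul_assoc[symmetric] symmetric_inner)
qed

lemma inv_sqrt_norm:
  fixes x :: "real ^ 'n"
  shows "(inv_sqrt (diagm w) *v x) \<bullet> (diagm w *v (inv_sqrt (diagm w) *v x)) = x \<bullet> x"
proof -
  have "w $ i * (1 / sqrt (w $ i) * x $ i)\<^sup>2 = x $ i * x $ i" for i
    using w[rule_format, of i]
    by (simp add: power_mult_distrib power_divide) (simp add: power2_eq_square)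
  then show ?thesis
    by (simp add: diagm_inner inv_sqrt_diagm[OF w] diagm_mult_vec)
      (simp add: inner_vec_def)
qed

text \<open>Lets a bound for all \<open>x\<close> become a bound for all \<open>y\<close> under the
  substitution; the preimage of \<open>y\<close> is its product with the square root of
  \<open>diagm w\<close>.\<close>

lemma inv_sqrt_surj: "\<exists>x. y = inv_sqrt (diagm w) *v x"
proof -
  have "w $ i \<noteq> 0" for i
    using w by (metis less_irrefl)
  then have "y = inv_sqrt (diagm w) *v (diagm (\<chi> i. sqrt (w $ i)) *v y)"
    by (simp add: vec_eq_iff inv_sqrt_diagm[OF w] diagm_mult_vec)
  then show ?thesis ..
qed

lemma loewner_le_scaled_iff:
  shows "a *\<^sub>R diagm w \<preceq> b *\<^sub>R M \<longleftrightarrow> (\<forall>y. a * (y \<bullet> (diagm w *v y)) \<le> b * (y \<bullet> (M *v y)))"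
    and "b *\<^sub>R M \<preceq> a *\<^sub>R diagm w \<longleftrightarrow> (\<forall>y. b * (y \<bullet> (M *v y)) \<le> a * (y \<bullet> (diagm w *v y)))"
proof -
  have "symmetric (b *\<^sub>R M - a *\<^sub>R diagm w)" "symmetric (a *\<^sub>R diagm w - b *\<^sub>R M)"
    using M symmetric_diagm[of w]
    by (simp_all add: symmetric_def transpose_def vec_eq_iff)
  then show "a *\<^sub>R diagm w \<preceq> b *\<^sub>R M \<longleftrightarrow> (\<forall>y. a * (y \<bullet> (diagm w *v y)) \<le> b * (y \<bullet> (M *v y)))"
    and "b *\<^sub>R M \<preceq> a *\<^sub>R diagm w \<longleftrightarrow> (\<forall>y. b * (y \<bullet> (M *v y)) \<le> a * (y \<bullet> (diagm w *v y)))"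
    by (simp_all add: loewner_le_def pos_semidef_def matrix_vector_mult_diff_rdistrib
        scaleR_matrix_vector_assoc[symmetric] inner_diff_right)
qed

lemma le_lambda_min_precond_iff:
  "a \<le> lambda_min (precond (diagm w) M) \<longleftrightarrow> a *\<^sub>R diagm w \<preceq> M"
proof -
  have "a \<le> lambda_min (precond (diagm w) M) \<longleftrightarrow>
      (\<forall>y. a * (y \<bullet> (diagm w *v y)) \<le> y \<bullet> (M *v y))"
    unfolding le_lambda_min_iff[OF symmetric_precond] precond_quadratic_form
    by (metis inv_sqrt_norm inv_sqrt_surj)
  then show ?thesis
    using loewner_le_scaled_iff(1)[of a 1] by simp
qed

lemma lambda_max_precond_le_iff:
  "lambda_max (precond (diagm w) M) \<le> b \<longleftrightarrow> M \<preceq> b *\<^sub>R diagm w"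
proof -
  have "lambda_max (precond (diagm w) M) \<le> b \<longleftrightarrow>
      (\<forall>y. y \<bullet> (M *v y) \<le> b * (y \<bullet> (diagm w *v y)))"
    unfolding lambda_max_le_iff[OF symmetric_precond] precond_quadratic_form
    by (metis inv_sqrt_norm inv_sqrt_surj)
  then show ?thesis
    using loewner_le_scaled_iff(2)[of 1 b] by simp
qed

end

text \<open>By \<open>inv_sqrt_norm\<close> the inverse root kills no nonzero vector, so positivity
  of the form of \<open>M\<close> carries over.\<close>

lemma pos_def_precond:
  assumes w: "\<forall>i. 0 < w $ i" and M: "pos_def M"
  shows "pos_def (precond (diagm w) M)"
proof -
  have sym: "symmetric M" using M by (simp add: pos_def_def)
  have "inv_sqrt (diagm w) *v x \<noteq> 0" if "x \<noteq> 0" for x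
    using inv_sqrt_norm[OF w sym, of x] that by auto
  with M show ?thesis
    unfolding pos_def_def
    by (simp add: symmetric_precond[OF w sym] precond_quadratic_form[OF w sym])
qed

section \<open>The semidefinite program\<close>

lemma loewner_le_0_iff: "A - B \<preceq> 0 \<longleftrightarrow> A \<preceq> B"
  by (simp add: loewner_le_def)

lemma diag_comb_eq_diagm: "diag_comb d z = diagm (\<Sum>i\<in>UNIV. z $ i *\<^sub>R d i)"
  by (simp add: diag_comb_def diagm_def vec_eq_iff)

lemma scaleR_diagm: "c *\<^sub>R diagm w = diagm (c *\<^sub>R w)"
  by (simp add: diagm_def vec_eq_iff)

lemma diag_comb_axis: "diag_comb d (axis i c) = c *\<^sub>R diagm (d i)"
  by (simp add: diag_comb_def axis_def if_distrib[of "\<lambda>a. a *\<^sub>R _"] cong: if_cong)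

lemma sdp_feasible_single:
  fixes M :: "real ^ 'n ^ 'n" and d :: "'k :: finite \<Rightarrow> real ^ 'n"
  assumes M: "pos_def M" and di: "\<forall>j. 0 < d i $ j"
  defines "P \<equiv> precond (diagm (d i)) M"
  shows "sdp_feasible M d (lambda_min P / lambda_max P) (axis i (lambda_min P))"
proof -
  have sym: "symmetric M" using M by (simp add: pos_def_def)
  have "pos_def P" unfolding P_def by (rule pos_def_precond[OF di M])
  then have "0 < lambda_min P" "lambda_min P \<le> lambda_max P"
    by (simp_all add: pos_def_lambda_min_pos lambda_min_le_max pos_def_def)
  then have pos: "0 < lambda_min P" "0 < lambda_max P" by simp_all
  have low: "lambda_min P *\<^sub>R diagm (d i) \<preceq> M"
    using le_lambda_min_precond_iff[OF di sym, of "lambda_min P"] by (simp add: P_def)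
  have "M \<preceq> lambda_max P *\<^sub>R diagm (d i)"
    using lambda_max_precond_le_iff[OF di sym, of "lambda_max P"] by (simp add: P_def)
  then have up: "y \<bullet> (M *v y) \<le> lambda_max P * (y \<bullet> (diagm (d i) *v y))" for y
    using loewner_le_scaled_iff(2)[OF di sym, of 1] by simp
  \<comment> \<open>Multiplying the upper bound by \<open>lambda_min P / lambda_max P\<close> turns
    its coefficient into \<open>lambda_min P\<close>, the one used in \<open>low\<close>: one
    rescaled matrix serves both constraints.\<close>
  have "lambda_min P / lambda_max P * (y \<bullet> (M *v y)) \<le> lambda_min P * (y \<bullet> (diagm (d i) *v y))" for y
    using mult_left_mono[OF up[of y], of "lambda_min P / lambda_max P"] pos by simp
  then have "(lambda_min P / lambda_max P) *\<^sub>R M \<preceq> lambda_min P *\<^sub>R diagm (d i)"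
    unfolding loewner_le_scaled_iff(2)[OF di sym] by blast
  with low show ?thesis
    by (simp add: sdp_feasible_def loewner_le_0_iff diag_comb_axis)
qed

lemma cond_num_feasible_le:
  fixes M :: "real ^ 'n ^ 'n"
  assumes M: "pos_def M" and feas: "sdp_feasible M d \<tau> z" and \<tau>: "0 < \<tau>"
  shows "cond_num (precond (diag_comb d z) M) \<le> 1 / \<tau>"
proof -
  define w where "w = (\<Sum>i\<in>UNIV. z $ i *\<^sub>R d i)"
  have sym: "symmetric M" using M by (simp add: pos_def_def)
  have low: "\<tau> *\<^sub>R M \<preceq> diagm w" and up: "diagm w \<preceq> M"
    using feas by (simp_all add: sdp_feasible_def loewner_le_0_iff diag_comb_eq_diagm w_def)
  have form: "\<tau> * (y \<bullet> (M *v y)) \<le> y \<bullet> (diagm w *v y)" for y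
    using low by (simp add: loewner_le_def pos_semidef_def matrix_vector_mult_diff_rdistrib
        scaleR_matrix_vector_assoc[symmetric] inner_diff_right)
  \<comment> \<open>Entries of \<open>z\<close> may be negative, so positivity of the diagonal comes
    from the first constraint tested on unit vectors: \<open>w $ i\<close> is at least \<tau> times
    a diagonal entry of \<open>M\<close>.\<close>
  have w: "\<forall>i. 0 < w $ i"
  proof
    fix i
    have "axis i 1 \<noteq> (0 :: real ^ 'n)" by (simp add: axis_eq_0_iff)
    then have "0 < \<tau> * (axis i 1 \<bullet> (M *v axis i 1))"
      using M \<tau> by (simp add: pos_def_def)
    also have "\<dots> \<le> w $ i"
      using form[of "axis i 1"] by (simp add: inner_axis' diagm_mult_vec)
    finally show "0 < w $ i" .
  qed
  let ?P = "precond (diagm w) M"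
  have "1 \<le> lambda_min ?P"
    using le_lambda_min_precond_iff[OF w sym] up by simp
  \<comment> \<open>The first constraint divided by \<tau>.\<close>
  moreover have "M \<preceq> (1 / \<tau>) *\<^sub>R diagm w"
    using loewner_le_scaled_iff(2)[OF w sym, of 1 "1 / \<tau>"] form \<tau> by (simp add: field_simps)
  then have "lambda_max ?P \<le> 1 / \<tau>"
    using lambda_max_precond_le_iff[OF w sym] by simp
  ultimately have "lambda_max ?P / lambda_min ?P \<le> (1 / \<tau>) / 1"
    using \<tau> by (intro frac_le) auto
  then show ?thesis
    by (simp add: cond_num_def diag_comb_eq_diagm w_def)
qed

theorem theorem3p1:
  fixes M :: "real ^ 'n ^ 'n"
    and d :: "'k :: finite \<Rightarrow> real ^ 'n"
    and \<tau> :: real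
    and z :: "real ^ 'k"
  assumes "pos_def M"
    and "\<forall>i j. 0 < d i $ j"
    and "sdp_optimal M d \<tau> z"
  shows "cond_num (precond (diag_comb d z) M)
           \<le> (MIN i. cond_num (precond (diagm (d i)) M))"
proof -
  have "cond_num (precond (diag_comb d z) M) \<le> cond_num (precond (diagm (d i)) M)" for i
  proof -
    let ?P = "precond (diagm (d i)) M"
    have di: "\<forall>j. 0 < d i $ j" using assms(2) by blast
    have "pos_def ?P" by (rule pos_def_precond[OF di assms(1)])
    then have "0 < lambda_min ?P" "lambda_min ?P \<le> lambda_max ?P"
      by (simp_all add: pos_def_lambda_min_pos lambda_min_le_max pos_def_def)
    then have pos: "0 < lambda_min ?P / lambda_max ?P" by simp
    \<comment> \<open>Optimality is compared with the feasible point on the \<open>i\<close>-th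
      axis; as its value is positive, so is \<tau>.\<close>
    have le: "lambda_min ?P / lambda_max ?P \<le> \<tau>"
      using sdp_feasible_single[where d = d, OF assms(1) di] assms(3) by (auto simp: sdp_optimal_def)
    have "cond_num (precond (diag_comb d z) M) \<le> 1 / \<tau>"
      using assms(1,3) pos le by (intro cond_num_feasible_le) (auto simp: sdp_optimal_def)
    also have "\<dots> \<le> 1 / (lambda_min ?P / lambda_max ?P)"
      using pos le by (intro frac_le) simp_all
    finally show ?thesis by (simp add: cond_num_def)
  qed
  \<comment> \<open>The index type is finite and nonempty, so a bound for each \<open>i\<close>
    bounds the minimum.\<close>
  then show ?thesis by simp
qed

end
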